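(* Let $A\in\mathbb{R}^{n\times n}$, $q\in\mathbb{R}^n$, $\zeta:\mathbb{R}^n\to\mathbb{R}^n$ a mapping, and $\gamma>0$ a constant. Let $\Omega_1,\Omega_2\in\mathbb{R}^{n\times n}$ be positive diagonal matrices, let $\phi\in\mathbb{R}^{n\times n}$ be a diagonal matrix, and let $A=(M+\phi)-(N+\phi)$ be a splitting of $A$ with $M,N\in\mathbb{R}^{n\times n}$. Then the implicit complementarity problem $\mathrm{ICP}(q,A,\zeta)$ is equivalent to the equation $$(\Omega_2+M\Omega_1+\phi\Omega_1)x=(N\Omega_1+\phi\Omega_1)x+(\Omega_2-A\Omega_1)|x|-\gamma A\zeta(z)-\gamma q,$$ where $x$ and $z$ are related by $z-\zeta(z)=\frac{1}{\gamma}\Omega_1(|x|+x)$. That is, a vector $z\in\mathbb{R}^n$ solves $\mathrm{ICP}(q,A,\zeta)$ if and only if there is a vector $x\in\mathbb{R}^n$ with $z-\zeta(z)=\frac{1}{\gamma}\Omega_1(|x|+x)$ such that the displayed equation holds.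
   Context: The problem $\mathrm{ICP}(q,A,\zeta)$ is to find $z\in\mathbb{R}^n$ such that $Az+q\ge 0$, $z-\zeta(z)\ge 0$ and $(z-\zeta(z))^T(Az+q)=0$, with inequalities understood componentwise. For a vector $x$, $|x|$ is the vector of componentwise absolute values. A positive diagonal matrix is a diagonal matrix with all diagonal entries positive. A splitting $A=(M+\phi)-(N+\phi)$ just means $A=M-N$. *)

theory Defs
  imports "HOL-Analysis.Analysis"
begin

(* The order and the absolute value on real^'n are the library's componentwise ones
   (class ordered_euclidean_space). *)

definition solves_ICP ::
  "real^'n \<Rightarrow> real^'n^'n \<Rightarrow> (real^'n \<Rightarrow> real^'n) \<Rightarrow> real^'n \<Rightarrow> bool"
where
  "solves_ICP q A \<zeta> z \<longleftrightarrow>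
     A *v z + q \<ge> 0 \<and> z - \<zeta> z \<ge> 0 \<and> (z - \<zeta> z) \<bullet> (A *v z + q) = 0"

definition diagonal_matrix :: "real^'n^'n \<Rightarrow> bool" where
  "diagonal_matrix D \<longleftrightarrow> (\<forall>i j. i \<noteq> j \<longrightarrow> D $ i $ j = 0)"

definition positive_diagonal_matrix :: "real^'n^'n \<Rightarrow> bool" where
  "positive_diagonal_matrix D \<longleftrightarrow> diagonal_matrix D \<and> (\<forall>i. D $ i $ i > 0)"

end

(* With the relation between x and z, the splitting cancels and the equation becomes
   \<gamma> (A z + q) = \<Omega>2 (|x| - x), while z - \<zeta> z = \<Omega>1 (|x| + x) / \<gamma>.  So up to positive
   componentwise scaling, z - \<zeta> z and A z + q are twice the positive and the negative part of x,
   and two vectors arise in this way iff they are nonnegative and complementary. *)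

theory Submission
  imports Defs
begin

lemma diagonal_matrix_mult_vector_nth:
  fixes D :: "real^'n^'n"
  assumes "diagonal_matrix D"
  shows "(D *v x) $ i = D $ i $ i * x $ i"
proof -
  have "(D *v x) $ i = (\<Sum>j\<in>UNIV. if j = i then D $ i $ i * x $ i else 0)"
    unfolding matrix_vector_mult_def vec_lambda_beta
    by (rule sum.cong) (use assms in \<open>auto simp: diagonal_matrix_def\<close>)
  then show ?thesis by simp
qed

text \<open>The products \<open>a * (\<bar>x\<bar> + x)\<close> and
  \<open>b * (\<bar>x\<bar> - x)\<close> are nonnegative, and one of them vanishes according to the
  sign of \<open>x\<close>. Conversely, since \<open>u\<close> or \<open>w\<close> is zero, the
  other one fixes both the sign and the size of \<open>x\<close>.\<close>

lemma complementary_iff_scaled_parts: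
  fixes a b u w :: real
  assumes "a > 0" "b > 0"
  shows "0 \<le> u \<and> 0 \<le> w \<and> u * w = 0 \<longleftrightarrow>
    (\<exists>x. u = a * (\<bar>x\<bar> + x) \<and> w = b * (\<bar>x\<bar> - x))"
proof
  assume "0 \<le> u \<and> 0 \<le> w \<and> u * w = 0"
  then consider "w = 0" "0 \<le> u / a" | "u = 0" "0 \<le> w / b"
    using assms by auto
  then show "\<exists>x. u = a * (\<bar>x\<bar> + x) \<and> w = b * (\<bar>x\<bar> - x)"
  proof cases
    case 1
    \<comment> \<open>Here \<open>w = 0\<close> forces x \<ge> 0, so
      \<open>\<bar>x\<bar> + x\<close> is \<open>2 * x\<close>, and solving
      \<open>u = 2 * a * x\<close> gives the witness.\<close>
    then have "u = a * (\<bar>x\<bar> + x) \<and> w = b * (\<bar>x\<bar> - x)" if "x = u / (2 * a)" for x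
      using assms that by (simp add: zero_le_divide_iff)
    then show ?thesis by blast
  next
    case 2
    \<comment> \<open>Now \<open>u = 0\<close> forces x \<le> 0, so \<open>\<bar>x\<bar> - x\<close>
      is \<open>- 2 * x\<close>, which gives the witness with a minus sign.\<close>
    then have "u = a * (\<bar>x\<bar> + x) \<and> w = b * (\<bar>x\<bar> - x)" if "x = - (w / (2 * b))" for x
      using assms that by (simp add: zero_le_divide_iff)
    then show ?thesis by blast
  qed
next
  assume "\<exists>x. u = a * (\<bar>x\<bar> + x) \<and> w = b * (\<bar>x\<bar> - x)"
  then obtain x where "u = a * (\<bar>x\<bar> + x)" "w = b * (\<bar>x\<bar> - x)" by blast
  then show "0 \<le> u \<and> 0 \<le> w \<and> u * w = 0"
    using assms by (cases "x \<ge> 0") (auto simp: mult_le_0_iff)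
qed

text \<open>A sum of nonnegative terms vanishes only if every term does. This reduces vector
  complementarity to the scalar case.\<close>

lemma nonneg_inner_eq_0_iff:
  fixes u w :: "real^'n"
  shows "0 \<le> u \<and> 0 \<le> w \<and> u \<bullet> w = 0 \<longleftrightarrow> (\<forall>i. 0 \<le> u $ i \<and> 0 \<le> w $ i \<and> u $ i * w $ i = 0)"
proof -
  have "u \<bullet> w = 0 \<longleftrightarrow> (\<forall>i. u $ i * w $ i = 0)" if "0 \<le> u" "0 \<le> w"
    using that by (simp add: inner_vec_def less_eq_vec_def sum_nonneg_eq_0_iff)
  then show ?thesis by (auto simp: less_eq_vec_def)
qed

text \<open>Diagonal matrices act on each coordinate separately, so the scalar equivalence applies
  with the diagonal entries as scaling factors.\<close>

lemma complementary_iff_diagonal_parts: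
  fixes D E :: "real^'n^'n" and u w :: "real^'n"
  assumes "positive_diagonal_matrix D" "positive_diagonal_matrix E"
  shows "0 \<le> u \<and> 0 \<le> w \<and> u \<bullet> w = 0 \<longleftrightarrow>
    (\<exists>x. u = D *v (\<bar>x\<bar> + x) \<and> w = E *v (\<bar>x\<bar> - x))"
proof -
  have "0 \<le> u \<and> 0 \<le> w \<and> u \<bullet> w = 0 \<longleftrightarrow>
      (\<forall>i. \<exists>t. u $ i = D $ i $ i * (\<bar>t\<bar> + t) \<and> w $ i = E $ i $ i * (\<bar>t\<bar> - t))"
    unfolding nonneg_inner_eq_0_iff
    using assms
    by (intro all_cong1 complementary_iff_scaled_parts) (auto simp: positive_diagonal_matrix_def)
  also have "\<dots> \<longleftrightarrow> (\<exists>x::real^'n. \<forall>i. u $ i = D $ i $ i * (\<bar>x $ i\<bar> + x $ i) \<and>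
      w $ i = E $ i $ i * (\<bar>x $ i\<bar> - x $ i))"
    \<comment> \<open>The scalars chosen for the individual coordinates are collected into one
      vector \<open>x\<close>.\<close>
    by (rule lambda_skolem)
  also have "\<dots> \<longleftrightarrow> (\<exists>x. u = D *v (\<bar>x\<bar> + x) \<and> w = E *v (\<bar>x\<bar> - x))"
    using assms
    by (simp add: vec_eq_iff diagonal_matrix_mult_vector_nth positive_diagonal_matrix_def
        abs_vec_def all_conj_distrib)
  finally show ?thesis .
qed

theorem theorem3p1:
  fixes A M N \<phi> \<Omega>\<^sub>1 \<Omega>\<^sub>2 :: "real^'n^'n"
    and q z :: "real^'n"
    and \<zeta> :: "real^'n \<Rightarrow> real^'n"
    and \<gamma> :: real
  assumes "\<gamma> > 0"
    and "positive_diagonal_matrix \<Omega>\<^sub>1"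
    and "positive_diagonal_matrix \<Omega>\<^sub>2"
    and "diagonal_matrix \<phi>"
    and "A = (M + \<phi>) - (N + \<phi>)"
  shows "solves_ICP q A \<zeta> z \<longleftrightarrow>
    (\<exists>x :: real^'n.
       z - \<zeta> z = (1 / \<gamma>) *\<^sub>R (\<Omega>\<^sub>1 *v (\<bar>x\<bar> + x)) \<and>
       (\<Omega>\<^sub>2 + M ** \<Omega>\<^sub>1 + \<phi> ** \<Omega>\<^sub>1) *v x =
         (N ** \<Omega>\<^sub>1 + \<phi> ** \<Omega>\<^sub>1) *v x + (\<Omega>\<^sub>2 - A ** \<Omega>\<^sub>1) *v \<bar>x\<bar>
           - \<gamma> *\<^sub>R (A *v \<zeta> z) - \<gamma> *\<^sub>R q)"
proof -
  let ?u = "z - \<zeta> z" and ?w = "A *v z + q"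
  have eq: "(\<Omega>\<^sub>2 + M ** \<Omega>\<^sub>1 + \<phi> ** \<Omega>\<^sub>1) *v x =
         (N ** \<Omega>\<^sub>1 + \<phi> ** \<Omega>\<^sub>1) *v x + (\<Omega>\<^sub>2 - A ** \<Omega>\<^sub>1) *v \<bar>x\<bar>
           - \<gamma> *\<^sub>R (A *v \<zeta> z) - \<gamma> *\<^sub>R q \<longleftrightarrow> \<gamma> *\<^sub>R ?w = \<Omega>\<^sub>2 *v (\<bar>x\<bar> - x)"
    if x: "\<gamma> *\<^sub>R ?u = \<Omega>\<^sub>1 *v (\<bar>x\<bar> + x)" for x
  proof -
    \<comment> \<open>Applying \<open>A\<close> to the relation between \<open>x\<close> and
      \<open>z\<close> trades the terms in \<open>A ** \<Omega>\<^sub>1\<close> for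
      \<open>A *v z\<close> and \<open>A *v \<zeta> z\<close>.\<close>
    have "A *v (\<gamma> *\<^sub>R ?u) = A *v (\<Omega>\<^sub>1 *v (\<bar>x\<bar> + x))"
      by (simp only: x)
    then have "\<gamma> *\<^sub>R (A *v z) =
        \<gamma> *\<^sub>R (A *v \<zeta> z) + A *v (\<Omega>\<^sub>1 *v \<bar>x\<bar>) + A *v (\<Omega>\<^sub>1 *v x)"
      by (simp add: matrix_vector_mult_scaleR matrix_vector_mult_diff_distrib
          matrix_vector_right_distrib algebra_simps)
    \<comment> \<open>\<open>\<phi>\<close> cancels in the splitting, so \<open>M\<close> is
      \<open>A + N\<close>. After this substitution the \<open>N\<close> and \<open>\<phi>\<close>
      terms agree on both sides of the equation.\<close>
    moreover have "M *v y = A *v y + N *v y" for y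
      using assms(5) by (simp add: matrix_vector_mult_diff_rdistrib)
    ultimately show ?thesis
      by (auto simp: matrix_vector_mult_add_rdistrib matrix_vector_mult_diff_rdistrib
          matrix_vector_mult_diff_distrib matrix_vector_mul_assoc[symmetric] algebra_simps)
  qed
  \<comment> \<open>Scaling both vectors by \<gamma> > 0 preserves signs and orthogonality, and
    leaves exactly \<open>\<Omega>\<^sub>1\<close> and \<open>\<Omega>\<^sub>2\<close> as the
    diagonal scalings.\<close>
  have "solves_ICP q A \<zeta> z \<longleftrightarrow> 0 \<le> \<gamma> *\<^sub>R ?u \<and> 0 \<le> \<gamma> *\<^sub>R ?w \<and> (\<gamma> *\<^sub>R ?u) \<bullet> (\<gamma> *\<^sub>R ?w) = 0"
    unfolding solves_ICP_def using \<open>\<gamma> > 0\<close> by (auto simp: zero_le_scaleR_iff)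
  also have "\<dots> \<longleftrightarrow> (\<exists>x. \<gamma> *\<^sub>R ?u = \<Omega>\<^sub>1 *v (\<bar>x\<bar> + x) \<and> \<gamma> *\<^sub>R ?w = \<Omega>\<^sub>2 *v (\<bar>x\<bar> - x))"
    by (rule complementary_iff_diagonal_parts[OF assms(2,3)])
  moreover have "?u = (1 / \<gamma>) *\<^sub>R y \<longleftrightarrow> \<gamma> *\<^sub>R ?u = y" for y
    using \<open>\<gamma> > 0\<close> by auto
  ultimately show ?thesis
    \<comment> \<open>The first conjunct under the quantifier is the premise of \<open>eq\<close>,
      so the second conjunct can be exchanged for the same \<open>x\<close>.\<close>
    using eq by auto
qed

end
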